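(* Consider the buffered surgery-scheduling model defined in the context, and fix a day $d\in\mathcal D$ and any feasible solution of the model (all constraints (1)-(19) of the context; the solution may in addition be subject to the constraints of any of the three risk postures M1, M2, M3). Let $\mathcal J_d$ be the set of surgeries assigned to day $d$, let $(r(j),k(j),t(j))$ be the room, surgeon and menu level selected for $j\in\mathcal J_d$, let $p_j:=p^{(t(j))}_{j\,r(j)\,k(j)}$ and $X_j:=X_{j\,r(j)\,k(j)}$, and let $E_j:=\{X_j\le p_j\}$ and $E_d:=\bigcap_{j\in\mathcal J_d}E_j$. Let $F_d$ be the event that the realized schedule on day $d$ is feasible, i.e. it has no room-timeline overlap, no surgeon-timeline overlap, and completes within the planned room and surgeon horizons including allowed overtime. Then $$E_d\subseteq F_d ,\qquad\text{and consequently}\qquad \Pr(F_d^c)\le \Pr(E_d^c).$$ Moreover: (a) If the events $E_j$, $j\in\mathcal J_d$, are independent, then with $B_d:=\sum_{j\in\mathcal J_d}\log(1-\alpha_{t(j)})$, $$\Pr(F_d^c)\le\Pr(E_d^c)\le 1-e^{B_d},$$ and, since the model enforces $b_d\le B_d$, also $\Pr(F_d^c)\le 1-e^{b_d}$. (b) Under arbitrary dependence among the durations, $\Pr(F_d^c)\le\sum_{j\in\mathcal J_d}\alpha_{t(j)}$.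
   Context: **Data.** Finite sets of surgeries $\mathcal J$ (totally ordered by index), days $\mathcal D$, rooms $\mathcal R$, surgeons $\mathcal K$, and menu levels $\mathcal T=\{1,\dots,T\}$ with tail probabilities $0<\alpha_1<\dots<\alpha_T<1$ and $\ell_t:=\log(1-\alpha_t)$. A set $\mathcal V\subseteq\mathcal J\times\mathcal D\times\mathcal R\times\mathcal K\times\mathcal T$ of feasible tuples. Random durations $X_{jrk}$ and deterministic buffered durations $p^{(t)}_{jrk}\ge 0$ satisfying $\Pr(X_{jrk}\le p^{(t)}_{jrk})\ge 1-\alpha_t$. Room horizons $H_d$, surgeon capacities $C_{kd}$, overtime caps $\bar O^{\rm rm},\bar O^{\rm sg}$. Big-$M$ constants: with $P_{\max}=\max\{p^{(t)}_{jrk}:(j,d,r,k,t)\in\mathcal V\}$, $M_d^{\rm rm}=H_d+\bar O^{\rm rm}+P_{\max}$, $M_d^{\rm sg}=\max_k C_{kd}+\bar O^{\rm sg}+P_{\max}$, $M^{\rm link}=\max_d H_d+\bar O^{\rm rm}$. **Variables.** Binary $w_{jdrkt}$ (for $(j,d,r,k,t)\in\mathcal V$), binary $z_{jdr}$, $y_{jdk}$, binary sequencing variables $u^{\rm rm}_{ji\,dr},u^{\rm sg}_{ji\,dk}$ for $j<i$; nonnegative start times $s^{\rm rm}_{jdr},s^{\rm sg}_{jdk}$, induced durations $\delta^{\rm rm}_{jdr},\delta^{\rm sg}_{jdk}$, overtimes $o^{\rm rm}_{dr},o^{\rm sg}_{dk}$, idle times $I_{dr}$; and $b_d\le 0$.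 Sums below run only over tuples in $\mathcal V$; empty sums are zero. **Constraints** (for all applicable indices): (1) $\sum_{d,r,k,t}w_{jdrkt}=1$ for every $j$; (2) $z_{jdr}=\sum_{k,t}w_{jdrkt}$; (3) $y_{jdk}=\sum_{r,t}w_{jdrkt}$; (4) $\delta^{\rm rm}_{jdr}=\sum_{k,t}p^{(t)}_{jrk}w_{jdrkt}$; (5) $\delta^{\rm sg}_{jdk}=\sum_{r,t}p^{(t)}_{jrk}w_{jdrkt}$; (6) $|s^{\rm sg}_{jdk}-s^{\rm rm}_{jdr}|\le M^{\rm link}(1-w_{jdrkt})$ for $(j,d,r,k,t)\in\mathcal V$; (7) $s^{\rm rm}_{jdr}+\delta^{\rm rm}_{jdr}\le H_d+o^{\rm rm}_{dr}+M_d^{\rm rm}(1-z_{jdr})$; (8) $\sum_j\delta^{\rm sg}_{jdk}\le C_{kd}+o^{\rm sg}_{dk}$; (9) $s^{\rm sg}_{jdk}+\delta^{\rm sg}_{jdk}\le C_{kd}+o^{\rm sg}_{dk}+M_d^{\rm sg}(1-y_{jdk})$; (10) $I_{dr}=H_d+o^{\rm rm}_{dr}-\sum_j\delta^{\rm rm}_{jdr}$; (11) $0\le o^{\rm rm}_{dr}\le\bar O^{\rm rm}$; (12) $0\le o^{\rm sg}_{dk}\le\bar O^{\rm sg}$; (13) $\sum_{j,r,k,t}\ell_t w_{jdrkt}\ge b_d$ for every $d$; (14) $s^{\rm rm}_{jdr}\le M_d^{\rm rm}z_{jdr}$ and $s^{\rm sg}_{jdk}\le M_d^{\rm sg}y_{jdk}$;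 (15) for $j<i$: $u^{\rm rm}_{ji\,dr}\le z_{jdr}$, $u^{\rm rm}_{ji\,dr}\le z_{idr}$, $u^{\rm sg}_{ji\,dk}\le y_{jdk}$, $u^{\rm sg}_{ji\,dk}\le y_{idk}$; (16) for $j<i$: $s^{\rm rm}_{jdr}+\delta^{\rm rm}_{jdr}\le s^{\rm rm}_{idr}+M_d^{\rm rm}(1-u^{\rm rm}_{ji\,dr})+M_d^{\rm rm}(2-z_{jdr}-z_{idr})$; (17) for $j<i$: $s^{\rm rm}_{idr}+\delta^{\rm rm}_{idr}\le s^{\rm rm}_{jdr}+M_d^{\rm rm}u^{\rm rm}_{ji\,dr}+M_d^{\rm rm}(2-z_{jdr}-z_{idr})$; (18) for $j<i$: $s^{\rm sg}_{jdk}+\delta^{\rm sg}_{jdk}\le s^{\rm sg}_{idk}+M_d^{\rm sg}(1-u^{\rm sg}_{ji\,dk})+M_d^{\rm sg}(2-y_{jdk}-y_{idk})$; (19) for $j<i$: $s^{\rm sg}_{idk}+\delta^{\rm sg}_{idk}\le s^{\rm sg}_{jdk}+M_d^{\rm sg}u^{\rm sg}_{ji\,dk}+M_d^{\rm sg}(2-y_{jdk}-y_{idk})$. **Postures.** M1 adds no constraint; M2 adds a variable $b_{\min}\le0$ with $b_{\min}\le b_d$ for all $d$; M3 adds $b_d\ge\log(1-\varepsilon_{\rm target})$ for all $d$, for a given $\varepsilon_{\rm target}\in(0,1)$. (They differ otherwise only in the objective.) **Realized schedule.** $\mathcal J_d$ is the set of $j$ with $\sum_{r,k,t}w_{jdrkt}=1$.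 In the realized schedule on day $d$, surgery $j\in\mathcal J_d$ starts at its planned start times $s^{\rm rm}_{j\,d\,r(j)}$ (on the room timeline) and $s^{\rm sg}_{j\,d\,k(j)}$ (on the surgeon timeline) and lasts $X_j$. "No room-timeline overlap" means that for any two distinct surgeries assigned to the same room on day $d$, one of them has realized completion (start plus $X$) no later than the planned start of the other; "no surgeon-timeline overlap" is the same for surgeries with the same surgeon. "Completes within the planned horizons including allowed overtime" means $s^{\rm rm}_{j\,d\,r(j)}+X_j\le H_d+o^{\rm rm}_{d\,r(j)}$ and $s^{\rm sg}_{j\,d\,k(j)}+X_j\le C_{k(j)d}+o^{\rm sg}_{d\,k(j)}$ for all $j\in\mathcal J_d$. *)

theory Defs
  imports "HOL-Probability.Probability"
begin

text \<open>
  Types: \<open>'j\<close> surgeries (the linear order is the index order), \<open>'d\<close> days, \<open>'r\<close> rooms, \<open>'k\<close> surgeons,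
  \<open>'a\<close> sample space. Fields are indexed in the order of the subscripts \<open>j, d, r, k, t\<close>, except that
  surgeon capacities \<open>C\<^sub>k\<^sub>d\<close> are indexed by \<open>k, d\<close>. Values of a field outside its index set are irrelevant.
\<close>

record ('j, 'd, 'r, 'k, 'a) surgery_instance =
  surgeries :: "'j set"
  days :: "'d set"
  rooms :: "'r set"
  surgeons :: "'k set"
  num_levels :: nat
  alpha :: "nat \<Rightarrow> real"
  tuples :: "('j \<times> 'd \<times> 'r \<times> 'k \<times> nat) set"
  prob_sp :: "'a measure"
  dur :: "'j \<Rightarrow> 'r \<Rightarrow> 'k \<Rightarrow> 'a \<Rightarrow> real"
  buf_dur :: "'j \<Rightarrow> 'r \<Rightarrow> 'k \<Rightarrow> nat \<Rightarrow> real"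
  room_horizon :: "'d \<Rightarrow> real"
  surgeon_cap :: "'k \<Rightarrow> 'd \<Rightarrow> real"
  room_overtime_cap :: real
  surgeon_overtime_cap :: real

definition valid_instance :: "('j, 'd, 'r, 'k, 'a) surgery_instance \<Rightarrow> bool" where
  "valid_instance I \<longleftrightarrow>
     finite (surgeries I) \<and> finite (days I) \<and> finite (rooms I) \<and> finite (surgeons I) \<and>
     (\<forall>t\<in>{1..num_levels I}. 0 < alpha I t \<and> alpha I t < 1) \<and>
     strict_mono_on {1..num_levels I} (alpha I) \<and>
     tuples I \<subseteq> surgeries I \<times> days I \<times> rooms I \<times> surgeons I \<times> {1..num_levels I} \<and>
     prob_space (prob_sp I) \<and>
     (\<forall>(j, d, r, k, t)\<in>tuples I.
        dur I j r k \<in> borel_measurable (prob_sp I) \<and>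
        0 \<le> buf_dur I j r k t \<and>
        measure (prob_sp I) {\<omega> \<in> space (prob_sp I). dur I j r k \<omega> \<le> buf_dur I j r k t}
          \<ge> 1 - alpha I t)"

definition log_level :: "('j, 'd, 'r, 'k, 'a) surgery_instance \<Rightarrow> nat \<Rightarrow> real" where
  "log_level I t = ln (1 - alpha I t)"

text \<open>
  The maxima below are unspecified when taken over an empty set; this is harmless, since the constraints
  in which the respective constant occurs are then vacuous, or the model is infeasible by
  \<open>assignment\<close> (when there are surgeries but no feasible tuples).
\<close>

definition P_max :: "('j, 'd, 'r, 'k, 'a) surgery_instance \<Rightarrow> real" where
  "P_max I = Max {buf_dur I j r k t | j d r k t. (j, d, r, k, t) \<in> tuples I}"

definition bigM_rm :: "('j, 'd, 'r, 'k, 'a) surgery_instance \<Rightarrow> 'd \<Rightarrow> real" where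
  "bigM_rm I d = room_horizon I d + room_overtime_cap I + P_max I"

definition bigM_sg :: "('j, 'd, 'r, 'k, 'a) surgery_instance \<Rightarrow> 'd \<Rightarrow> real" where
  "bigM_sg I d = Max ((\<lambda>k. surgeon_cap I k d) ` surgeons I) + surgeon_overtime_cap I + P_max I"

definition bigM_link :: "('j, 'd, 'r, 'k, 'a) surgery_instance \<Rightarrow> real" where
  "bigM_link I = Max (room_horizon I ` days I) + room_overtime_cap I"

record ('j, 'd, 'r, 'k) surgery_solution =
  w_var :: "'j \<Rightarrow> 'd \<Rightarrow> 'r \<Rightarrow> 'k \<Rightarrow> nat \<Rightarrow> real"
  z_var :: "'j \<Rightarrow> 'd \<Rightarrow> 'r \<Rightarrow> real"
  y_var :: "'j \<Rightarrow> 'd \<Rightarrow> 'k \<Rightarrow> real"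
  u_rm :: "'j \<Rightarrow> 'j \<Rightarrow> 'd \<Rightarrow> 'r \<Rightarrow> real"
  u_sg :: "'j \<Rightarrow> 'j \<Rightarrow> 'd \<Rightarrow> 'k \<Rightarrow> real"
  s_rm :: "'j \<Rightarrow> 'd \<Rightarrow> 'r \<Rightarrow> real"
  s_sg :: "'j \<Rightarrow> 'd \<Rightarrow> 'k \<Rightarrow> real"
  delta_rm :: "'j \<Rightarrow> 'd \<Rightarrow> 'r \<Rightarrow> real"
  delta_sg :: "'j \<Rightarrow> 'd \<Rightarrow> 'k \<Rightarrow> real"
  o_rm :: "'d \<Rightarrow> 'r \<Rightarrow> real"
  o_sg :: "'d \<Rightarrow> 'k \<Rightarrow> real"
  idle :: "'d \<Rightarrow> 'r \<Rightarrow> real"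
  b_var :: "'d \<Rightarrow> real"

definition variable_domains ::
  "('j::linorder, 'd, 'r, 'k, 'a) surgery_instance \<Rightarrow> ('j, 'd, 'r, 'k) surgery_solution \<Rightarrow> bool" where
  "variable_domains I S \<longleftrightarrow>
     (\<forall>(j, d, r, k, t)\<in>tuples I. w_var S j d r k t \<in> {0, 1}) \<and>
     (\<forall>j\<in>surgeries I. \<forall>d\<in>days I. \<forall>r\<in>rooms I.
        z_var S j d r \<in> {0, 1} \<and> 0 \<le> s_rm S j d r \<and> 0 \<le> delta_rm S j d r) \<and>
     (\<forall>j\<in>surgeries I. \<forall>d\<in>days I. \<forall>k\<in>surgeons I.
        y_var S j d k \<in> {0, 1} \<and> 0 \<le> s_sg S j d k \<and> 0 \<le> delta_sg S j d k) \<and>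
     (\<forall>j\<in>surgeries I. \<forall>i\<in>surgeries I. j < i \<longrightarrow>
        (\<forall>d\<in>days I. (\<forall>r\<in>rooms I. u_rm S j i d r \<in> {0, 1}) \<and>
                    (\<forall>k\<in>surgeons I. u_sg S j i d k \<in> {0, 1}))) \<and>
     (\<forall>d\<in>days I. \<forall>r\<in>rooms I. 0 \<le> o_rm S d r \<and> 0 \<le> idle S d r) \<and>
     (\<forall>d\<in>days I. \<forall>k\<in>surgeons I. 0 \<le> o_sg S d k) \<and>
     (\<forall>d\<in>days I. b_var S d \<le> 0)"

definition assignment ::
  "('j, 'd, 'r, 'k, 'a) surgery_instance \<Rightarrow> ('j, 'd, 'r, 'k) surgery_solution \<Rightarrow> bool" where
  "assignment I S \<longleftrightarrow>
     (\<forall>j\<in>surgeries I.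
        (\<Sum>(d, r, k, t)\<in>{(d, r, k, t). (j, d, r, k, t) \<in> tuples I}. w_var S j d r k t) = 1) \<and>
     (\<forall>j\<in>surgeries I. \<forall>d\<in>days I. \<forall>r\<in>rooms I.
        z_var S j d r = (\<Sum>(k, t)\<in>{(k, t). (j, d, r, k, t) \<in> tuples I}. w_var S j d r k t)) \<and>
     (\<forall>j\<in>surgeries I. \<forall>d\<in>days I. \<forall>k\<in>surgeons I.
        y_var S j d k = (\<Sum>(r, t)\<in>{(r, t). (j, d, r, k, t) \<in> tuples I}. w_var S j d r k t))"

definition induced_durations ::
  "('j, 'd, 'r, 'k, 'a) surgery_instance \<Rightarrow> ('j, 'd, 'r, 'k) surgery_solution \<Rightarrow> bool" where
  "induced_durations I S \<longleftrightarrow>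
     (\<forall>j\<in>surgeries I. \<forall>d\<in>days I. \<forall>r\<in>rooms I.
        delta_rm S j d r =
          (\<Sum>(k, t)\<in>{(k, t). (j, d, r, k, t) \<in> tuples I}. buf_dur I j r k t * w_var S j d r k t)) \<and>
     (\<forall>j\<in>surgeries I. \<forall>d\<in>days I. \<forall>k\<in>surgeons I.
        delta_sg S j d k =
          (\<Sum>(r, t)\<in>{(r, t). (j, d, r, k, t) \<in> tuples I}. buf_dur I j r k t * w_var S j d r k t))"

definition start_linking ::
  "('j, 'd, 'r, 'k, 'a) surgery_instance \<Rightarrow> ('j, 'd, 'r, 'k) surgery_solution \<Rightarrow> bool" where
  "start_linking I S \<longleftrightarrow>
     (\<forall>(j, d, r, k, t)\<in>tuples I.
        \<bar>s_sg S j d k - s_rm S j d r\<bar> \<le> bigM_link I * (1 - w_var S j d r k t)) \<and>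
     (\<forall>j\<in>surgeries I. \<forall>d\<in>days I. \<forall>r\<in>rooms I. s_rm S j d r \<le> bigM_rm I d * z_var S j d r) \<and>
     (\<forall>j\<in>surgeries I. \<forall>d\<in>days I. \<forall>k\<in>surgeons I. s_sg S j d k \<le> bigM_sg I d * y_var S j d k)"

definition capacity_overtime ::
  "('j, 'd, 'r, 'k, 'a) surgery_instance \<Rightarrow> ('j, 'd, 'r, 'k) surgery_solution \<Rightarrow> bool" where
  "capacity_overtime I S \<longleftrightarrow>
     (\<forall>j\<in>surgeries I. \<forall>d\<in>days I. \<forall>r\<in>rooms I.
        s_rm S j d r + delta_rm S j d r
          \<le> room_horizon I d + o_rm S d r + bigM_rm I d * (1 - z_var S j d r)) \<and>
     (\<forall>d\<in>days I. \<forall>k\<in>surgeons I.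
        (\<Sum>j\<in>surgeries I. delta_sg S j d k) \<le> surgeon_cap I k d + o_sg S d k) \<and>
     (\<forall>j\<in>surgeries I. \<forall>d\<in>days I. \<forall>k\<in>surgeons I.
        s_sg S j d k + delta_sg S j d k
          \<le> surgeon_cap I k d + o_sg S d k + bigM_sg I d * (1 - y_var S j d k)) \<and>
     (\<forall>d\<in>days I. \<forall>r\<in>rooms I.
        idle S d r = room_horizon I d + o_rm S d r - (\<Sum>j\<in>surgeries I. delta_rm S j d r)) \<and>
     (\<forall>d\<in>days I. \<forall>r\<in>rooms I. 0 \<le> o_rm S d r \<and> o_rm S d r \<le> room_overtime_cap I) \<and>
     (\<forall>d\<in>days I. \<forall>k\<in>surgeons I. 0 \<le> o_sg S d k \<and> o_sg S d k \<le> surgeon_overtime_cap I)"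

definition risk_budget ::
  "('j, 'd, 'r, 'k, 'a) surgery_instance \<Rightarrow> ('j, 'd, 'r, 'k) surgery_solution \<Rightarrow> bool" where
  "risk_budget I S \<longleftrightarrow>
     (\<forall>d\<in>days I.
        (\<Sum>(j, r, k, t)\<in>{(j, r, k, t). (j, d, r, k, t) \<in> tuples I}. log_level I t * w_var S j d r k t)
          \<ge> b_var S d)"

definition room_sequencing ::
  "('j::linorder, 'd, 'r, 'k, 'a) surgery_instance \<Rightarrow> ('j, 'd, 'r, 'k) surgery_solution \<Rightarrow> bool" where
  "room_sequencing I S \<longleftrightarrow>
     (\<forall>j\<in>surgeries I. \<forall>i\<in>surgeries I. j < i \<longrightarrow> (\<forall>d\<in>days I. \<forall>r\<in>rooms I.
        u_rm S j i d r \<le> z_var S j d r \<and> u_rm S j i d r \<le> z_var S i d r \<and>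
        s_rm S j d r + delta_rm S j d r
          \<le> s_rm S i d r + bigM_rm I d * (1 - u_rm S j i d r)
              + bigM_rm I d * (2 - z_var S j d r - z_var S i d r) \<and>
        s_rm S i d r + delta_rm S i d r
          \<le> s_rm S j d r + bigM_rm I d * u_rm S j i d r
              + bigM_rm I d * (2 - z_var S j d r - z_var S i d r)))"

definition surgeon_sequencing ::
  "('j::linorder, 'd, 'r, 'k, 'a) surgery_instance \<Rightarrow> ('j, 'd, 'r, 'k) surgery_solution \<Rightarrow> bool" where
  "surgeon_sequencing I S \<longleftrightarrow>
     (\<forall>j\<in>surgeries I. \<forall>i\<in>surgeries I. j < i \<longrightarrow> (\<forall>d\<in>days I. \<forall>k\<in>surgeons I.
        u_sg S j i d k \<le> y_var S j d k \<and> u_sg S j i d k \<le> y_var S i d k \<and>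
        s_sg S j d k + delta_sg S j d k
          \<le> s_sg S i d k + bigM_sg I d * (1 - u_sg S j i d k)
              + bigM_sg I d * (2 - y_var S j d k - y_var S i d k) \<and>
        s_sg S i d k + delta_sg S i d k
          \<le> s_sg S j d k + bigM_sg I d * u_sg S j i d k
              + bigM_sg I d * (2 - y_var S j d k - y_var S i d k)))"

definition model_feasible ::
  "('j::linorder, 'd, 'r, 'k, 'a) surgery_instance \<Rightarrow> ('j, 'd, 'r, 'k) surgery_solution \<Rightarrow> bool" where
  "model_feasible I S \<longleftrightarrow>
     variable_domains I S \<and> assignment I S \<and> induced_durations I S \<and> start_linking I S \<and>
     capacity_overtime I S \<and> risk_budget I S \<and> room_sequencing I S \<and> surgeon_sequencing I S"

text \<open>
  The argument of \<open>M3\<close> is the target \<open>\<epsilon>\<close>. The auxiliary variable that \<open>M2\<close> adds to the model is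
  existentially quantified.
\<close>

datatype posture = M1 | M2 | M3 real

fun posture_constraints ::
  "posture \<Rightarrow> ('j, 'd, 'r, 'k, 'a) surgery_instance \<Rightarrow> ('j, 'd, 'r, 'k) surgery_solution \<Rightarrow> bool" where
  "posture_constraints M1 I S \<longleftrightarrow> True"
| "posture_constraints M2 I S \<longleftrightarrow> (\<exists>b_min::real. b_min \<le> 0 \<and> (\<forall>d\<in>days I. b_min \<le> b_var S d))"
| "posture_constraints (M3 \<epsilon>) I S \<longleftrightarrow>
     0 < \<epsilon> \<and> \<epsilon> < 1 \<and> (\<forall>d\<in>days I. ln (1 - \<epsilon>) \<le> b_var S d)"

definition day_surgeries ::
  "('j, 'd, 'r, 'k, 'a) surgery_instance \<Rightarrow> ('j, 'd, 'r, 'k) surgery_solution \<Rightarrow> 'd \<Rightarrow> 'j set" where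
  "day_surgeries I S d =
     {j \<in> surgeries I.
        (\<Sum>(r, k, t)\<in>{(r, k, t). (j, d, r, k, t) \<in> tuples I}. w_var S j d r k t) = 1}"

text \<open>
  The triple \<open>(r(j), k(j), t(j))\<close>. The description is proper for \<open>j \<in> day_surgeries I S d\<close>
  and feasible \<open>S\<close>; see \<open>selected_unique\<close> below.
\<close>

definition selected ::
  "('j, 'd, 'r, 'k, 'a) surgery_instance \<Rightarrow> ('j, 'd, 'r, 'k) surgery_solution \<Rightarrow> 'd \<Rightarrow> 'j
     \<Rightarrow> 'r \<times> 'k \<times> nat" where
  "selected I S d j = (THE (r, k, t). (j, d, r, k, t) \<in> tuples I \<and> w_var S j d r k t = 1)"

definition room_of ::
  "('j, 'd, 'r, 'k, 'a) surgery_instance \<Rightarrow> ('j, 'd, 'r, 'k) surgery_solution \<Rightarrow> 'd \<Rightarrow> 'j \<Rightarrow> 'r" where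
  "room_of I S d j = fst (selected I S d j)"

definition surgeon_of ::
  "('j, 'd, 'r, 'k, 'a) surgery_instance \<Rightarrow> ('j, 'd, 'r, 'k) surgery_solution \<Rightarrow> 'd \<Rightarrow> 'j \<Rightarrow> 'k" where
  "surgeon_of I S d j = fst (snd (selected I S d j))"

definition level_of ::
  "('j, 'd, 'r, 'k, 'a) surgery_instance \<Rightarrow> ('j, 'd, 'r, 'k) surgery_solution \<Rightarrow> 'd \<Rightarrow> 'j \<Rightarrow> nat" where
  "level_of I S d j = snd (snd (selected I S d j))"

definition planned_dur ::
  "('j, 'd, 'r, 'k, 'a) surgery_instance \<Rightarrow> ('j, 'd, 'r, 'k) surgery_solution \<Rightarrow> 'd \<Rightarrow> 'j \<Rightarrow> real" where
  "planned_dur I S d j = buf_dur I j (room_of I S d j) (surgeon_of I S d j) (level_of I S d j)"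

definition realized_dur ::
  "('j, 'd, 'r, 'k, 'a) surgery_instance \<Rightarrow> ('j, 'd, 'r, 'k) surgery_solution \<Rightarrow> 'd \<Rightarrow> 'j \<Rightarrow> 'a \<Rightarrow> real" where
  "realized_dur I S d j = dur I j (room_of I S d j) (surgeon_of I S d j)"

definition room_start ::
  "('j, 'd, 'r, 'k, 'a) surgery_instance \<Rightarrow> ('j, 'd, 'r, 'k) surgery_solution \<Rightarrow> 'd \<Rightarrow> 'j \<Rightarrow> real" where
  "room_start I S d j = s_rm S j d (room_of I S d j)"

definition surgeon_start ::
  "('j, 'd, 'r, 'k, 'a) surgery_instance \<Rightarrow> ('j, 'd, 'r, 'k) surgery_solution \<Rightarrow> 'd \<Rightarrow> 'j \<Rightarrow> real" where
  "surgeon_start I S d j = s_sg S j d (surgeon_of I S d j)"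

definition surgery_event ::
  "('j, 'd, 'r, 'k, 'a) surgery_instance \<Rightarrow> ('j, 'd, 'r, 'k) surgery_solution \<Rightarrow> 'd \<Rightarrow> 'j \<Rightarrow> 'a set" where
  "surgery_event I S d j = {\<omega> \<in> space (prob_sp I). realized_dur I S d j \<omega> \<le> planned_dur I S d j}"

text \<open>Intersecting with the sample space makes the empty intersection the sure event.\<close>

definition day_event ::
  "('j, 'd, 'r, 'k, 'a) surgery_instance \<Rightarrow> ('j, 'd, 'r, 'k) surgery_solution \<Rightarrow> 'd \<Rightarrow> 'a set" where
  "day_event I S d = space (prob_sp I) \<inter> (\<Inter>j\<in>day_surgeries I S d. surgery_event I S d j)"

definition no_room_overlap ::
  "('j, 'd, 'r, 'k, 'a) surgery_instance \<Rightarrow> ('j, 'd, 'r, 'k) surgery_solution \<Rightarrow> 'd \<Rightarrow> 'a \<Rightarrow> bool" where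
  "no_room_overlap I S d \<omega> \<longleftrightarrow>
     (\<forall>j\<in>day_surgeries I S d. \<forall>i\<in>day_surgeries I S d.
        j \<noteq> i \<and> room_of I S d j = room_of I S d i \<longrightarrow>
          room_start I S d j + realized_dur I S d j \<omega> \<le> room_start I S d i \<or>
          room_start I S d i + realized_dur I S d i \<omega> \<le> room_start I S d j)"

definition no_surgeon_overlap ::
  "('j, 'd, 'r, 'k, 'a) surgery_instance \<Rightarrow> ('j, 'd, 'r, 'k) surgery_solution \<Rightarrow> 'd \<Rightarrow> 'a \<Rightarrow> bool" where
  "no_surgeon_overlap I S d \<omega> \<longleftrightarrow>
     (\<forall>j\<in>day_surgeries I S d. \<forall>i\<in>day_surgeries I S d.
        j \<noteq> i \<and> surgeon_of I S d j = surgeon_of I S d i \<longrightarrow>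
          surgeon_start I S d j + realized_dur I S d j \<omega> \<le> surgeon_start I S d i \<or>
          surgeon_start I S d i + realized_dur I S d i \<omega> \<le> surgeon_start I S d j)"

definition within_horizons ::
  "('j, 'd, 'r, 'k, 'a) surgery_instance \<Rightarrow> ('j, 'd, 'r, 'k) surgery_solution \<Rightarrow> 'd \<Rightarrow> 'a \<Rightarrow> bool" where
  "within_horizons I S d \<omega> \<longleftrightarrow>
     (\<forall>j\<in>day_surgeries I S d.
        room_start I S d j + realized_dur I S d j \<omega>
          \<le> room_horizon I d + o_rm S d (room_of I S d j) \<and>
        surgeon_start I S d j + realized_dur I S d j \<omega>
          \<le> surgeon_cap I (surgeon_of I S d j) d + o_sg S d (surgeon_of I S d j))"

definition feasible_event ::
  "('j, 'd, 'r, 'k, 'a) surgery_instance \<Rightarrow> ('j, 'd, 'r, 'k) surgery_solution \<Rightarrow> 'd \<Rightarrow> 'a set" where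
  "feasible_event I S d =
     {\<omega> \<in> space (prob_sp I).
        no_room_overlap I S d \<omega> \<and> no_surgeon_overlap I S d \<omega> \<and> within_horizons I S d \<omega>}"

definition day_log_budget ::
  "('j, 'd, 'r, 'k, 'a) surgery_instance \<Rightarrow> ('j, 'd, 'r, 'k) surgery_solution \<Rightarrow> 'd \<Rightarrow> real" where
  "day_log_budget I S d = (\<Sum>j\<in>day_surgeries I S d. ln (1 - alpha I (level_of I S d j)))"

lemma sum_binary_eq_1_unique:
  fixes f :: "'b \<Rightarrow> real"
  assumes "finite A" "\<And>x. x \<in> A \<Longrightarrow> f x \<in> {0, 1}" "sum f A = 1"
  shows "\<exists>!x. x \<in> A \<and> f x = 1"
proof -
  have "sum f A = (\<Sum>x\<in>A. if f x = 1 then 1 else 0)"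
    using assms(2) by (intro sum.cong) auto
  also have "\<dots> = real (card {x \<in> A. f x = 1})"
    using assms(1) by (simp add: sum.If_cases Int_def)
  finally have "card {x \<in> A. f x = 1} = 1" using assms(3) by simp
  then obtain a where "{x \<in> A. f x = 1} = {a}" by (metis card_1_singletonE)
  then have "x \<in> A \<and> f x = 1 \<longleftrightarrow> x = a" for x by (auto simp: set_eq_iff)
  then show ?thesis by simp
qed

lemma finite_tuples: "valid_instance I \<Longrightarrow> finite (tuples I)"
  unfolding valid_instance_def
  by (elim conjE, rule finite_subset, assumption) (simp add: finite_SigmaI)

lemma selected_unique:
  assumes "valid_instance I" "variable_domains I S" "j \<in> day_surgeries I S d"
  shows "\<exists>!(r, k, t). (j, d, r, k, t) \<in> tuples I \<and> w_var S j d r k t = 1"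
proof -
  let ?A = "{(r, k, t). (j, d, r, k, t) \<in> tuples I}"
  have "?A \<subseteq> (snd \<circ> snd) ` tuples I" by force
  then have "finite ?A"
    using finite_tuples[OF assms(1)] finite_surj by blast
  then have "\<exists>!x. x \<in> ?A \<and> (case x of (r, k, t) \<Rightarrow> w_var S j d r k t) = 1"
    using assms(2,3) by (intro sum_binary_eq_1_unique)
      (auto simp: variable_domains_def day_surgeries_def)
  then show ?thesis by (simp add: split_def)
qed

end

theory Submission
  imports Defs
begin

text \<open>
  For a surgery assigned to the day, exactly one tuple variable \<open>w\<close> is \<open>1\<close>, so its induced durations
  are the planned duration and the big-M terms switched by \<open>z\<close> and \<open>y\<close> vanish for its own room and
  surgeon, while the binary \<open>u\<close> enforces one of the two orders of each pair.
  The sequencing and horizon constraints then hold with planned durations, hence on \<open>E\<^sub>d\<close> also with the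
  shorter realized ones. The probability bounds follow from \<open>Pr(E\<^sub>j) \<ge> 1 - \<alpha>\<^sub>t\<^sub>(\<^sub>j\<^sub>)\<close> by the product rule
  and by the union bound.
\<close>

locale feasible_day =
  fixes I :: "('j::linorder, 'd, 'r, 'k, 'a) surgery_instance"
    and S :: "('j, 'd, 'r, 'k) surgery_solution"
    and d :: 'd
  assumes valid: "valid_instance I"
    and feasible: "model_feasible I S"
    and day: "d \<in> days I"
begin

sublocale prob_space "prob_sp I"
  using valid by (simp add: valid_instance_def)

abbreviation "J\<^sub>d \<equiv> day_surgeries I S d"
abbreviation "room \<equiv> room_of I S d"
abbreviation "surgeon \<equiv> surgeon_of I S d"
abbreviation "level \<equiv> level_of I S d"
abbreviation "p \<equiv> planned_dur I S d"
abbreviation "X \<equiv> realized_dur I S d"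
abbreviation "E \<equiv> surgery_event I S d"

section \<open>The tuple selected for each surgery of the day\<close>

lemma domains: "variable_domains I S"
  using feasible by (simp add: model_feasible_def)

lemma finite_day_surgeries [simp]: "finite J\<^sub>d"
  using valid by (simp add: day_surgeries_def valid_instance_def)

lemma day_surgeryD: "j \<in> J\<^sub>d \<Longrightarrow> j \<in> surgeries I"
  by (simp add: day_surgeries_def)

lemma tupleD:
  assumes "(j, d', r, k, t) \<in> tuples I"
  shows "j \<in> surgeries I" "d' \<in> days I" "r \<in> rooms I" "k \<in> surgeons I" "t \<in> {1..num_levels I}"
    "w_var S j d' r k t \<in> {0, 1}" "0 < alpha I t" "alpha I t < 1"
proof -
  have "(j, d', r, k, t) \<in> surgeries I \<times> days I \<times> rooms I \<times> surgeons I \<times> {1..num_levels I}"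
    using valid assms unfolding valid_instance_def by blast
  then show "j \<in> surgeries I" "d' \<in> days I" "r \<in> rooms I" "k \<in> surgeons I"
    and t: "t \<in> {1..num_levels I}"
    by auto
  show "w_var S j d' r k t \<in> {0, 1}"
    using domains assms by (auto simp: variable_domains_def)
  show "0 < alpha I t" "alpha I t < 1"
    using valid t by (auto simp: valid_instance_def)
qed

text \<open>Trades the definite description in \<open>selected\<close> for an equivalence, so that
  later arguments can test any tuple against the selection.\<close>

lemma selected_iff:
  assumes "j \<in> J\<^sub>d"
  shows "(j, d, r, k, t) \<in> tuples I \<and> w_var S j d r k t = 1
    \<longleftrightarrow> r = room j \<and> k = surgeon j \<and> t = level j"
proof -
  let ?P = "\<lambda>(r, k, t). (j, d, r, k, t) \<in> tuples I \<and> w_var S j d r k t = 1"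
  have ex1: "\<exists>!x. ?P x"
    by (rule selected_unique[OF valid domains assms])
  then have "?P (r, k, t) \<longleftrightarrow> (r, k, t) = selected I S d j"
    unfolding selected_def by (rule theI_unique)
  then show ?thesis
    by (auto simp: room_of_def surgeon_of_def level_of_def prod_eq_iff)
qed

lemma selected_tuple: "j \<in> J\<^sub>d \<Longrightarrow> (j, d, room j, surgeon j, level j) \<in> tuples I"
  using selected_iff by blast

lemma w_var_day:
  assumes "j \<in> J\<^sub>d" "(j, d, r, k, t) \<in> tuples I"
  shows "w_var S j d r k t = (if r = room j \<and> k = surgeon j \<and> t = level j then 1 else 0)"
  using selected_iff[OF assms(1), of r k t] tupleD(6)[OF assms(2)] assms(2) by auto

text \<open>All terms are nonnegative, so the sum over day \<open>d\<close> is squeezed between the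
  single term 1 and the sum over all days, which the assignment constraint fixes at 1. Consequently
  surgeries outside \<open>J\<^sub>d\<close> have only zero variables on day \<open>d\<close>, which
  the risk budget needs.\<close>

lemma selected_imp_day_surgery:
  assumes "(j, d, r, k, t) \<in> tuples I" "w_var S j d r k t = 1"
  shows "j \<in> J\<^sub>d"
proof -
  let ?A = "{(d', r, k, t). (j, d', r, k, t) \<in> tuples I}"
  let ?B = "{(r, k, t). (j, d, r, k, t) \<in> tuples I}"
  let ?f = "\<lambda>(d', r, k, t). w_var S j d' r k t"
  let ?g = "\<lambda>(r, k, t). w_var S j d r k t"
  have "?A \<subseteq> snd ` tuples I"
    by force
  then have finA: "finite ?A"
    using finite_tuples[OF valid] finite_surj by blast
  have BA: "Pair d ` ?B \<subseteq> ?A"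
    by auto
  then have finB: "finite ?B"
    using finA by (meson finite_imageD finite_subset inj_on_def Pair_inject)
  have "sum ?g ?B = sum ?f (Pair d ` ?B)"
    by (subst sum.reindex) (auto simp: inj_on_def split_def)
  also have "\<dots> \<le> sum ?f ?A"
    using tupleD(6) by (intro sum_mono2 finA BA) fastforce
  also have "\<dots> = 1"
    using feasible tupleD(1)[OF assms(1)] by (auto simp: model_feasible_def assignment_def)
  finally have "sum ?g ?B \<le> 1" .
  moreover have "?g (r, k, t) \<le> sum ?g ?B"
    using tupleD(6) assms(1) by (intro member_le_sum finB) fastforce+
  ultimately have "sum ?g ?B = 1"
    using assms(2) by simp
  then show ?thesis
    using tupleD(1)[OF assms(1)] by (simp add: day_surgeries_def)
qed

text \<open>On the day \<open>w_var\<close> is an indicator of the selected tuple, so only one term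
  survives. The coefficient \<open>f\<close> is left general to serve two constraints: the constant
  1 yields \<open>z_var\<close>, the buffered duration yields \<open>delta_rm\<close>.\<close>

lemma sum_room_tuples:
  assumes "j \<in> J\<^sub>d"
  shows "(\<Sum>(k, t)\<in>{(k, t). (j, d, room j, k, t) \<in> tuples I}. f k t * w_var S j d (room j) k t)
    = f (surgeon j) (level j)"
proof -
  let ?A = "{(k, t). (j, d, room j, k, t) \<in> tuples I}"
  have "?A \<subseteq> (snd \<circ> snd \<circ> snd) ` tuples I"
    by force
  then have fin: "finite ?A"
    using finite_tuples[OF valid] finite_surj by blast
  have "(\<Sum>(k, t)\<in>?A. f k t * w_var S j d (room j) k t)
      = (\<Sum>x\<in>?A. if x = (surgeon j, level j) then f (surgeon j) (level j) else 0)"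
    by (intro sum.cong) (auto simp: w_var_day[OF assms] split: if_splits)
  also have "\<dots> = f (surgeon j) (level j)"
    using fin selected_tuple[OF assms] by simp
  finally show ?thesis .
qed

lemma sum_surgeon_tuples:
  assumes "j \<in> J\<^sub>d"
  shows "(\<Sum>(r, t)\<in>{(r, t). (j, d, r, surgeon j, t) \<in> tuples I}. f r t * w_var S j d r (surgeon j) t)
    = f (room j) (level j)"
proof -
  let ?A = "{(r, t). (j, d, r, surgeon j, t) \<in> tuples I}"
  have "?A \<subseteq> (\<lambda>(j, d, r, k, t). (r, t)) ` tuples I"
    by force
  then have fin: "finite ?A"
    using finite_tuples[OF valid] finite_surj by blast
  have "(\<Sum>(r, t)\<in>?A. f r t * w_var S j d r (surgeon j) t)
      = (\<Sum>x\<in>?A. if x = (room j, level j) then f (room j) (level j) else 0)"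
    by (intro sum.cong) (auto simp: w_var_day[OF assms] split: if_splits)
  also have "\<dots> = f (room j) (level j)"
    using fin selected_tuple[OF assms] by simp
  finally show ?thesis .
qed

lemma room_selected:
  assumes "j \<in> J\<^sub>d"
  shows "z_var S j d (room j) = 1" "delta_rm S j d (room j) = p j"
  using feasible day day_surgeryD[OF assms] tupleD(3)[OF selected_tuple[OF assms]]
    sum_room_tuples[OF assms, of "\<lambda>_ _. 1"] sum_room_tuples[OF assms, of "buf_dur I j (room j)"]
  by (simp_all add: model_feasible_def assignment_def induced_durations_def planned_dur_def)

lemma surgeon_selected:
  assumes "j \<in> J\<^sub>d"
  shows "y_var S j d (surgeon j) = 1" "delta_sg S j d (surgeon j) = p j"
  using feasible day day_surgeryD[OF assms] tupleD(4)[OF selected_tuple[OF assms]]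
    sum_surgeon_tuples[OF assms, of "\<lambda>_ _. 1"]
    sum_surgeon_tuples[OF assms, of "\<lambda>r. buf_dur I j r (surgeon j)"]
  by (simp_all add: model_feasible_def assignment_def induced_durations_def planned_dur_def)

section \<open>Sequencing and horizons with planned durations\<close>

lemma planned_room_order:
  assumes "j \<in> J\<^sub>d" "i \<in> J\<^sub>d" "j < i" "room j = room i"
  shows "room_start I S d j + p j \<le> room_start I S d i
    \<or> room_start I S d i + p i \<le> room_start I S d j"
proof -
  have r: "room j \<in> rooms I"
    using tupleD(3)[OF selected_tuple[OF assms(1)]] .
  have "room_sequencing I S"
    using feasible by (simp add: model_feasible_def)
  \<comment> \<open>Both surgeries occupy this room, so the factor
    \<open>2 - z_var S j d r - z_var S i d r\<close> is 0 and only the big-M term switched by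
    \<open>u_rm\<close> remains.\<close>
  then have
    "s_rm S j d (room j) + p j \<le> s_rm S i d (room j) + bigM_rm I d * (1 - u_rm S j i d (room j))"
    "s_rm S i d (room j) + p i \<le> s_rm S j d (room j) + bigM_rm I d * u_rm S j i d (room j)"
    using assms day r day_surgeryD room_selected[OF assms(1)] room_selected[OF assms(2)]
    unfolding room_sequencing_def by fastforce+
  moreover have "u_rm S j i d (room j) \<in> {0, 1}"
    using domains assms day r day_surgeryD by (simp add: variable_domains_def)
  ultimately show ?thesis
    using assms(4) by (auto simp: room_start_def)
qed

lemma planned_surgeon_order:
  assumes "j \<in> J\<^sub>d" "i \<in> J\<^sub>d" "j < i" "surgeon j = surgeon i"
  shows "surgeon_start I S d j + p j \<le> surgeon_start I S d i
    \<or> surgeon_start I S d i + p i \<le> surgeon_start I S d j"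
proof -
  have k: "surgeon j \<in> surgeons I"
    using tupleD(4)[OF selected_tuple[OF assms(1)]] .
  have "surgeon_sequencing I S"
    using feasible by (simp add: model_feasible_def)
  then have
    "s_sg S j d (surgeon j) + p j
      \<le> s_sg S i d (surgeon j) + bigM_sg I d * (1 - u_sg S j i d (surgeon j))"
    "s_sg S i d (surgeon j) + p i \<le> s_sg S j d (surgeon j) + bigM_sg I d * u_sg S j i d (surgeon j)"
    using assms day k day_surgeryD surgeon_selected[OF assms(1)] surgeon_selected[OF assms(2)]
    unfolding surgeon_sequencing_def by fastforce+
  \<comment> \<open>The value 1 turns the first inequality into "j before i", the value 0 turns the
    second into "i before j".\<close>
  moreover have "u_sg S j i d (surgeon j) \<in> {0, 1}"
    using domains assms day k day_surgeryD by (simp add: variable_domains_def)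
  ultimately show ?thesis
    using assms(4) by (auto simp: surgeon_start_def)
qed

lemma planned_within_horizons:
  assumes "j \<in> J\<^sub>d"
  shows "room_start I S d j + p j \<le> room_horizon I d + o_rm S d (room j)"
    "surgeon_start I S d j + p j \<le> surgeon_cap I (surgeon j) d + o_sg S d (surgeon j)"
proof -
  have "capacity_overtime I S"
    using feasible by (simp add: model_feasible_def)
  then show "room_start I S d j + p j \<le> room_horizon I d + o_rm S d (room j)"
    "surgeon_start I S d j + p j \<le> surgeon_cap I (surgeon j) d + o_sg S d (surgeon j)"
    using day day_surgeryD[OF assms] tupleD(3,4)[OF selected_tuple[OF assms]]
      room_selected[OF assms] surgeon_selected[OF assms]
    unfolding capacity_overtime_def room_start_def surgeon_start_def by fastforce+
qed

lemma day_event_subset_feasible_event: "day_event I S d \<subseteq> feasible_event I S d"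
proof
  fix \<omega> assume \<omega>: "\<omega> \<in> day_event I S d"
  have X: "X j \<omega> \<le> p j" if "j \<in> J\<^sub>d" for j
    using \<omega> that by (auto simp: day_event_def surgery_event_def)
  have "no_room_overlap I S d \<omega>"
    unfolding no_room_overlap_def
  proof (intro ballI impI, elim conjE)
    fix j i assume "j \<in> J\<^sub>d" "i \<in> J\<^sub>d" "j \<noteq> i" "room j = room i"
    then show "room_start I S d j + X j \<omega> \<le> room_start I S d i
        \<or> room_start I S d i + X i \<omega> \<le> room_start I S d j"
      \<comment> \<open>Sequencing variables exist only for index-ordered pairs, while overlap is
        symmetric; hence both instances.\<close>
      using planned_room_order[of j i] planned_room_order[of i j] X[of i] X[of j]
      by (cases j i rule: linorder_cases) auto
  qed
  moreover have "no_surgeon_overlap I S d \<omega>"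
    unfolding no_surgeon_overlap_def
  proof (intro ballI impI, elim conjE)
    fix j i assume "j \<in> J\<^sub>d" "i \<in> J\<^sub>d" "j \<noteq> i" "surgeon j = surgeon i"
    then show "surgeon_start I S d j + X j \<omega> \<le> surgeon_start I S d i
        \<or> surgeon_start I S d i + X i \<omega> \<le> surgeon_start I S d j"
      using planned_surgeon_order[of j i] planned_surgeon_order[of i j] X[of i] X[of j]
      by (cases j i rule: linorder_cases) auto
  qed
  moreover have "within_horizons I S d \<omega>"
    using planned_within_horizons X unfolding within_horizons_def by fastforce
  ultimately show "\<omega> \<in> feasible_event I S d"
    using \<omega> by (simp add: feasible_event_def day_event_def)
qed

section \<open>Measurability of the events\<close>

lemma realized_dur_measurable: "j \<in> J\<^sub>d \<Longrightarrow> X j \<in> borel_measurable (prob_sp I)"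
  using valid selected_tuple unfolding valid_instance_def realized_dur_def by fastforce

lemma surgery_event_sets: "j \<in> J\<^sub>d \<Longrightarrow> E j \<in> events"
  using realized_dur_measurable[measurable] unfolding surgery_event_def by measurable

lemma day_event_sets: "day_event I S d \<in> events"
proof (cases "J\<^sub>d = {}")
  case False
  then show ?thesis
    unfolding day_event_def by (intro sets.Int sets.top sets.finite_INT) (auto simp: surgery_event_sets)
qed (simp add: day_event_def)

lemma feasible_event_sets: "feasible_event I S d \<in> events"
proof -
  \<comment> \<open>Starts, horizons and overtimes are deterministic, so every atomic condition of
    the event has this form; the rest is finite Boolean combination.\<close>
  have [measurable]: "{\<omega> \<in> space (prob_sp I). c + X j \<omega> \<le> c'} \<in> events" if "j \<in> J\<^sub>d" for c c' j
    using realized_dur_measurable[OF that, measurable] by measurable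
  show ?thesis
    unfolding feasible_event_def no_room_overlap_def no_surgeon_overlap_def within_horizons_def
    by (intro sets.sets_Collect_conj sets.sets_Collect_finite_All sets.sets_Collect_imp
        sets.sets_Collect_disj sets.sets_Collect_const)
      auto
qed

section \<open>Probability bounds\<close>

lemma prob_infeasible_le:
  "prob (space (prob_sp I) - feasible_event I S d) \<le> prob (space (prob_sp I) - day_event I S d)"
  using day_event_subset_feasible_event day_event_sets by (intro finite_measure_mono) auto

lemma prob_surgery_event_ge: "j \<in> J\<^sub>d \<Longrightarrow> 1 - alpha I (level j) \<le> prob (E j)"
  using valid selected_tuple
  unfolding valid_instance_def surgery_event_def realized_dur_def planned_dur_def by fastforce

lemma alpha_level_less_1: "j \<in> J\<^sub>d \<Longrightarrow> alpha I (level j) < 1"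
  using tupleD(8) selected_tuple by blast

text \<open>The risk budget constraint sums over all tuples of the day; discarding those with zero
  variable leaves one log term per surgery in \<open>J\<^sub>d\<close>.\<close>

lemma b_var_le_day_log_budget: "b_var S d \<le> day_log_budget I S d"
proof -
  let ?Q = "{(j, r, k, t). (j, d, r, k, t) \<in> tuples I}"
  let ?sel = "\<lambda>j. (j, room j, surgeon j, level j)"
  have "?Q \<subseteq> (\<lambda>(j, d, r, k, t). (j, r, k, t)) ` tuples I"
    by force
  then have fin: "finite ?Q"
    using finite_tuples[OF valid] finite_surj by blast
  have "b_var S d \<le> (\<Sum>(j, r, k, t)\<in>?Q. log_level I t * w_var S j d r k t)"
    using feasible day by (auto simp: model_feasible_def risk_budget_def)
  also have "\<dots> = (\<Sum>(j, r, k, t)\<in>?sel ` J\<^sub>d. log_level I t * w_var S j d r k t)"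
  proof (intro sum.mono_neutral_right fin ballI)
    show "?sel ` J\<^sub>d \<subseteq> ?Q"
      using selected_tuple by auto
    fix q assume q: "q \<in> ?Q - ?sel ` J\<^sub>d"
    obtain j r k t where [simp]: "q = (j, r, k, t)"
      by (cases q)
    \<comment> \<open>A variable equal to 1 would put \<open>j\<close> into \<open>J\<^sub>d\<close>
      and make this tuple its selection, hence a member of the image of \<open>?sel\<close>.\<close>
    have "w_var S j d r k t \<noteq> 1"
      using q selected_imp_day_surgery[of j r k t] selected_iff[of j r k t] by auto
    then show "(case q of (j, r, k, t) \<Rightarrow> log_level I t * w_var S j d r k t) = 0"
      using q tupleD(6)[of j d r k t] by auto
  qed
  also have "\<dots> = day_log_budget I S d"
    unfolding day_log_budget_def
    by (subst sum.reindex) (auto simp: inj_on_def log_level_def w_var_day selected_tuple intro!: sum.cong)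
  finally show ?thesis .
qed

lemma prob_not_day_event_le_if_indep:
  assumes "indep_events E J\<^sub>d"
  shows "prob (space (prob_sp I) - day_event I S d) \<le> 1 - exp (day_log_budget I S d)"
proof -
  \<comment> \<open>Each factor is positive, so \<open>exp\<close> undoes \<open>ln\<close> here,
    and the products can next be compared factor by factor.\<close>
  have "exp (day_log_budget I S d) = (\<Prod>j\<in>J\<^sub>d. 1 - alpha I (level j))"
    unfolding day_log_budget_def using alpha_level_less_1 by (auto simp: exp_sum intro!: prod.cong)
  also have "\<dots> \<le> (\<Prod>j\<in>J\<^sub>d. prob (E j))"
    using prob_surgery_event_ge alpha_level_less_1 by (intro prod_mono) (auto simp: less_imp_le)
  also have "\<dots> = prob (day_event I S d)"
  \<comment> \<open>\<open>indep_events\<close> gives the product rule for nonempty index sets only.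
    With no surgeries the product is 1 and the day event is the whole sample space.\<close>
  proof (cases "J\<^sub>d = {}")
    case True
    then show ?thesis by (simp add: day_event_def prob_space)
  next
    case False
    then have "day_event I S d = (\<Inter>j\<in>J\<^sub>d. E j)"
      by (auto simp: day_event_def surgery_event_def)
    then show ?thesis
      using assms False unfolding indep_events_def by simp
  qed
  finally show ?thesis
    using prob_compl[OF day_event_sets] by simp
qed

text \<open>The day event fails exactly when some surgery overruns its buffer, so subadditivity
  suffices whatever the dependence.\<close>

lemma prob_not_day_event_le_sum:
  "prob (space (prob_sp I) - day_event I S d) \<le> (\<Sum>j\<in>J\<^sub>d. alpha I (level j))"
proof -
  have "space (prob_sp I) - day_event I S d = (\<Union>j\<in>J\<^sub>d. space (prob_sp I) - E j)"
    by (auto simp: day_event_def)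
  also have "prob \<dots> \<le> (\<Sum>j\<in>J\<^sub>d. prob (space (prob_sp I) - E j))"
    using surgery_event_sets by (intro finite_measure_subadditive_finite) auto
  also have "\<dots> \<le> (\<Sum>j\<in>J\<^sub>d. alpha I (level j))"
    using prob_compl[OF surgery_event_sets] prob_surgery_event_ge
    by (intro sum_mono) (fastforce simp: algebra_simps)
  finally show ?thesis .
qed

end

theorem proposition3:
  fixes I :: "('j::linorder, 'd, 'r, 'k, 'a) surgery_instance"
    and S :: "('j, 'd, 'r, 'k) surgery_solution"
    and ps :: posture
    and d :: 'd
  assumes "valid_instance I"
    and "model_feasible I S"
    and "posture_constraints ps I S"
    and "d \<in> days I"
  shows "day_event I S d \<in> sets (prob_sp I) \<and>
    feasible_event I S d \<in> sets (prob_sp I) \<and>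
    day_event I S d \<subseteq> feasible_event I S d \<and>
    measure (prob_sp I) (space (prob_sp I) - feasible_event I S d)
      \<le> measure (prob_sp I) (space (prob_sp I) - day_event I S d) \<and>
    b_var S d \<le> day_log_budget I S d \<and>
    (prob_space.indep_events (prob_sp I) (surgery_event I S d) (day_surgeries I S d) \<longrightarrow>
      measure (prob_sp I) (space (prob_sp I) - feasible_event I S d)
        \<le> measure (prob_sp I) (space (prob_sp I) - day_event I S d) \<and>
      measure (prob_sp I) (space (prob_sp I) - day_event I S d)
        \<le> 1 - exp (day_log_budget I S d) \<and>
      measure (prob_sp I) (space (prob_sp I) - feasible_event I S d)
        \<le> 1 - exp (b_var S d)) \<and>
    measure (prob_sp I) (space (prob_sp I) - feasible_event I S d)
      \<le> (\<Sum>j\<in>day_surgeries I S d. alpha I (level_of I S d j))"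
proof -
  interpret feasible_day I S d
    using assms by unfold_locales
  have "exp (b_var S d) \<le> exp (day_log_budget I S d)"
    using b_var_le_day_log_budget by simp
  then have "prob (space (prob_sp I) - feasible_event I S d) \<le> 1 - exp (b_var S d)"
    if "indep_events E J\<^sub>d"
    using prob_infeasible_le prob_not_day_event_le_if_indep[OF that] by linarith
  then show ?thesis
    using day_event_sets feasible_event_sets day_event_subset_feasible_event prob_infeasible_le
      b_var_le_day_log_budget prob_not_day_event_le_if_indep prob_not_day_event_le_sum
    by (auto intro: order_trans)
qed

end
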